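(* Let $\mathcal{C}$ be a category, $P\in Pro\,\mathcal{C}$ a pro-object, and $F=[P,-]:\mathcal{C}\to\mathcal{E}ns$ the corresponding prorepresentable functor. Assume: (i) every arrow $Y\to X$ in $\mathcal{C}$ is a strict epimorphism; (ii) for every $X\in\mathcal{C}$ there exists $P\to X$, that is, $FX\neq\emptyset$; (iii) $F$ preserves strict epimorphisms. Then every arrow $x:P\to X$ with $X\in\mathcal{C}$ is the categorical quotient, relative to the category $\mathcal{C}$, of $P$ by the action of the Galois group $lFix(x)$. Equivalently, in terms of $F$ (Lifting Lemma): given any objects $X,Y\in\mathcal{C}$ and elements $x\in FX$, $y\in FY$, if $lFix(x)\le lFix(y)$ in $lAut(F)$, then there exists a unique arrow $f:X\to Y$ in $\mathcal{C}$ such that $F(f)(x)=y$.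
   Context: $\mathcal{E}ns$ is the category of sets. $[P,-]$ is the filtered colimit of the representables defining the pro-object $P$; arrows $P\to X$ are elements of $FX$. Prorepresentability of $F$ means that its diagram $\Gamma_F$ (objects: pairs $(x,X)$ with $x\in FX$; arrows $(x,X)\to(y,Y)$: arrows $f:X\to Y$ with $F(f)(x)=y$) is cofiltered. An arrow $f:X\to Y$ is a strict epimorphism if for every $g:X\to Z$ such that for all $s,t:C\to X$, $fs=ft$ implies $gs=gt$, there is a unique $h:Y\to Z$ with $g=hf$. A locale is a complete lattice in which finite infima distribute over arbitrary suprema; morphisms preserve finite infima and arbitrary suprema. Definition of $lAut(F)$. Let $D_{\Delta F}$ be the preordered set with elements $(X,(x_0,x_1))$, $X\in\mathcal{C}$, $x_0,x_1\in FX$, where $(X,(x_0,x_1))\le(Y,(y_0,y_1))$ iff there is $f:X\to Y$ with $F(f)(x_0)=y_0$, $F(f)(x_1)=y_1$. Let $\mathcal{D}(D_{\Delta F})$ be the free inf-lattice on it: its objects $[A]$ are given by finite subsets $A\subset D_{\Delta F}$, with $[A]\le[B]$ iff for every $b\in B$ there is $a\in A$ with $a\le b$; $[A]\wedge[B]=[A\cup B]$, $1=[\emptyset]$; the object of the singleton $\{(X,(x_0,x_1))\}$ is written $[(X,<\!x_0|x_1\!>)]$. Basic covers, for each $X$ and $z\in FX$: the empty family covers $[(X,<\!z|x\!>),(X,<\!z|y\!>)]$ and $[(X,<\!x|z\!>),(X,<\!y|z\!>)]$ for $x\ne y$ in $FX$; the families $\{[(X,<\!x|z\!>)]\}_{x\in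 FX}$ and $\{[(X,<\!z|x\!>)]\}_{x\in FX}$ cover $1$. The covers are those of the (pre)topology generated (closing under isomorphisms, pullback i.e. infimum with an object, and composition). $lAut(F)$ is the locale of sheaves, i.e. of downward closed subsets $T$ such that for each cover $u_\alpha\to u$, if all $u_\alpha\in T$ then $u\in T$; $\#:\mathcal{D}(D_{\Delta F})\to lAut(F)$ is the associated sheaf map, sending an object to the smallest sheaf containing it. It is a localic group (points: natural automorphisms of $F$), and $lAut(P)$ is the same locale with the opposite multiplication. For $x\in FX$, the Galois group $lFix(x)$, informally $\{h\in Aut(P)\mid xh=x\}$, is the open subgroup given by the element $lFix(x)=\#[(X,<\!x|x\!>)]$ of the locale $lAut(F)$. That $x:P\to X$ is the categorical quotient, relative to $\mathcal{C}$, of $P$ by $lFix(x)$ means: for every $Y\in\mathcal{C}$ and every $y:P\to Y$ invariant under $lFix(x)$, i.e. with $lFix(x)\le lFix(y)$, there is a unique arrow $f:X\to Y$ in $\mathcal{C}$ with $fx=y$. *)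

theory Defs
  imports Main "HOL-Library.FuncSet"
begin

section \<open>Categories and functors\<close>

record ('o, 'a) cat_data =
  Obj :: "'o set"
  Arr :: "'a set"
  Dom :: "'a \<Rightarrow> 'o"
  Cod :: "'a \<Rightarrow> 'o"
  Ident :: "'o \<Rightarrow> 'a"
  Comp :: "'a \<Rightarrow> 'a \<Rightarrow> 'a"  (* Comp C g f is g after f *)

definition hom :: "('o, 'a) cat_data \<Rightarrow> 'o \<Rightarrow> 'o \<Rightarrow> 'a set" where
  "hom C X Y = {f \<in> Arr C. Dom C f = X \<and> Cod C f = Y}"

locale category =
  fixes C :: "('o, 'a) cat_data"
  assumes dom_closed: "f \<in> Arr C \<Longrightarrow> Dom C f \<in> Obj C"
    and cod_closed: "f \<in> Arr C \<Longrightarrow> Cod C f \<in> Obj C"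
    and ident_hom: "X \<in> Obj C \<Longrightarrow> Ident C X \<in> hom C X X"
    and comp_hom: "\<lbrakk>f \<in> hom C X Y; g \<in> hom C Y Z\<rbrakk> \<Longrightarrow> Comp C g f \<in> hom C X Z"
    and comp_ident_right: "f \<in> hom C X Y \<Longrightarrow> Comp C f (Ident C X) = f"
    and comp_ident_left: "f \<in> hom C X Y \<Longrightarrow> Comp C (Ident C Y) f = f"
    and comp_assoc: "\<lbrakk>f \<in> hom C W X; g \<in> hom C X Y; h \<in> hom C Y Z\<rbrakk>
      \<Longrightarrow> Comp C h (Comp C g f) = Comp C (Comp C h g) f"

record ('o, 'a, 'p, 'b) functor_data =
  FOb :: "'o \<Rightarrow> 'p"
  FAr :: "'a \<Rightarrow> 'b"

locale cat_functor = dom: category C + cod: category D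
  for C :: "('o, 'a) cat_data" and D :: "('p, 'b) cat_data" +
  fixes F :: "('o, 'a, 'p, 'b) functor_data"
  assumes ob_closed: "X \<in> Obj C \<Longrightarrow> FOb F X \<in> Obj D"
    and ar_hom: "f \<in> hom C X Y \<Longrightarrow> FAr F f \<in> hom D (FOb F X) (FOb F Y)"
    and map_ident: "X \<in> Obj C \<Longrightarrow> FAr F (Ident C X) = Ident D (FOb F X)"
    and map_comp: "\<lbrakk>f \<in> hom C X Y; g \<in> hom C Y Z\<rbrakk>
      \<Longrightarrow> FAr F (Comp C g f) = Comp D (FAr F g) (FAr F f)"

definition strict_epi :: "('o, 'a) cat_data \<Rightarrow> 'a \<Rightarrow> bool" where
  "strict_epi C f \<longleftrightarrow> f \<in> Arr C \<and>
    (\<forall>Z \<in> Obj C. \<forall>g \<in> hom C (Dom C f) Z.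
      (\<forall>W \<in> Obj C. \<forall>s \<in> hom C W (Dom C f). \<forall>t \<in> hom C W (Dom C f).
        Comp C f s = Comp C f t \<longrightarrow> Comp C g s = Comp C g t) \<longrightarrow>
      (\<exists>!h. h \<in> hom C (Cod C f) Z \<and> g = Comp C h f))"

definition preserves_strict_epi ::
  "('o, 'a) cat_data \<Rightarrow> ('p, 'b) cat_data \<Rightarrow> ('o, 'a, 'p, 'b) functor_data \<Rightarrow> bool" where
  "preserves_strict_epi C D F \<longleftrightarrow> (\<forall>f. strict_epi C f \<longrightarrow> strict_epi D (FAr F f))"

definition cofiltered :: "('o, 'a) cat_data \<Rightarrow> bool" where
  "cofiltered C \<longleftrightarrow> Obj C \<noteq> {} \<and>
    (\<forall>X \<in> Obj C. \<forall>Y \<in> Obj C. \<exists>Z \<in> Obj C. hom C Z X \<noteq> {} \<and> hom C Z Y \<noteq> {}) \<and>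
    (\<forall>X \<in> Obj C. \<forall>Y \<in> Obj C. \<forall>f \<in> hom C X Y. \<forall>g \<in> hom C X Y.
      \<exists>Z \<in> Obj C. \<exists>e \<in> hom C Z X. Comp C f e = Comp C g e)"

section \<open>The category of sets\<close>

text \<open>
  The category of all sets of elements of a type \<^typ>\<open>'e\<close>. A map is extensional outside its
  source and carries its source and target. As soon as \<^typ>\<open>'e\<close> has two elements the strict
  epimorphisms of this category are the surjections (lemma \<open>strict_epi_Ens_iff\<close>), so
  restricting the test objects to sets over \<^typ>\<open>'e\<close> does not affect the notion.
\<close>

type_synonym 'e ens_arr = "'e set \<times> ('e \<Rightarrow> 'e) \<times> 'e set"

definition Ens :: "('e set, 'e ens_arr) cat_data" where
  "Ens = \<lparr>
    Obj = UNIV,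
    Arr = {(A, f, B). f \<in> A \<rightarrow>\<^sub>E B},
    Dom = (\<lambda>(A, f, B). A),
    Cod = (\<lambda>(A, f, B). B),
    Ident = (\<lambda>A. (A, restrict id A, A)),
    Comp = (\<lambda>(B', g, C) (A, f, B). (A, compose A g f, C))\<rparr>"

definition ens_app :: "'e ens_arr \<Rightarrow> 'e \<Rightarrow> 'e" where
  "ens_app m = fst (snd m)"

lemma Ens_simps [simp]:
  "Obj Ens = UNIV"
  "(A, f, B) \<in> Arr Ens \<longleftrightarrow> f \<in> A \<rightarrow>\<^sub>E B"
  "Dom Ens (A, f, B) = A"
  "Cod Ens (A, f, B) = B"
  "Ident Ens A = (A, restrict id A, A)"
  "Comp Ens (B', g, D) (A, f, B) = (A, compose A g f, D)"
  by (simp_all add: Ens_def)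

lemma hom_Ens: "hom Ens A B = {(A, f, B) | f. f \<in> A \<rightarrow>\<^sub>E B}"
  by (auto simp: hom_def)

lemma category_Ens: "category Ens"
proof
  fix A B :: "'e set" and m
  assume "m \<in> hom Ens A B"
  then show "Comp Ens m (Ident Ens A) = m" "Comp Ens (Ident Ens B) m = m"
    by (auto simp: hom_Ens compose_def restrict_def PiE_iff extensional_def fun_eq_iff)
next
  fix A B C D :: "'e set" and f g h
  assume "f \<in> hom Ens A B" "g \<in> hom Ens B C" "h \<in> hom Ens C D"
  then show "Comp Ens h (Comp Ens g f) = Comp Ens (Comp Ens h g) f"
    by (auto simp: hom_Ens compose_def restrict_def PiE_iff fun_eq_iff)
qed (auto simp: hom_Ens hom_def compose_def PiE_iff)

lemma Comp_Ens_eq_iff: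
  assumes "f \<in> A \<rightarrow>\<^sub>E B" "h \<in> B \<rightarrow>\<^sub>E Z" "g \<in> A \<rightarrow>\<^sub>E Z"
  shows "(A, g, Z) = Comp Ens (B, h, Z) (A, f, B) \<longleftrightarrow> (\<forall>a \<in> A. g a = h (f a))"
proof
  show "(A, g, Z) = Comp Ens (B, h, Z) (A, f, B)" if "\<forall>a \<in> A. g a = h (f a)"
    using that assms by (auto simp: compose_def intro!: PiE_ext)
qed (simp add: compose_def)

lemma strict_epi_Ens_iff:
  fixes A B :: "'e set"
  assumes two: "\<exists>a b :: 'e. a \<noteq> b" and m: "f \<in> A \<rightarrow>\<^sub>E B"
  shows "strict_epi Ens (A, f, B) \<longleftrightarrow> f ` A = B"
proof
  assume epi: "strict_epi Ens (A, f, B)"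
  show "f ` A = B"
  proof (rule ccontr)
    assume "f ` A \<noteq> B"
    with m obtain b where b: "b \<in> B" "b \<notin> f ` A" by (auto simp: PiE_iff)
    obtain p q :: 'e where pq: "p \<noteq> q" using two by blast
    let ?g = "(A, restrict (\<lambda>_. p) A, UNIV)"
    have g: "?g \<in> hom Ens A UNIV" by (auto simp: hom_Ens)
    have resp: "Comp Ens ?g s = Comp Ens ?g t"
      if st: "s \<in> hom Ens W A" "t \<in> hom Ens W A" for W s t
    proof -
      obtain s' t' where "s = (W, s', A)" "s' \<in> W \<rightarrow>\<^sub>E A" "t = (W, t', A)" "t' \<in> W \<rightarrow>\<^sub>E A"
        using st unfolding hom_Ens by blast
      then show ?thesis by (auto simp: compose_def fun_eq_iff restrict_def PiE_iff)
    qed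
    let ?H = "\<lambda>h. h \<in> hom Ens B UNIV \<and> ?g = Comp Ens h (A, f, B)"
    have uniq: "\<exists>!h. ?H h"
      using epi[unfolded strict_epi_def, THEN conjunct2, rule_format, of UNIV ?g] g resp
      unfolding Ens_simps by blast
    have g': "restrict (\<lambda>_. p) A \<in> A \<rightarrow>\<^sub>E UNIV" by auto
    have H: "?H (B, restrict h B, UNIV)" if "\<forall>a \<in> A. h (f a) = p" for h
    proof -
      have h: "restrict h B \<in> B \<rightarrow>\<^sub>E UNIV" by auto
      have "\<forall>a \<in> A. restrict (\<lambda>_. p) A a = restrict h B (f a)" using that m by (auto simp: PiE_iff)
      then show ?thesis unfolding Comp_Ens_eq_iff[OF m h g'] using h by (simp add: hom_Ens)
    qed
    have "?H (B, restrict (\<lambda>_. p) B, UNIV)" by (rule H) simp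
    moreover have "?H (B, restrict (\<lambda>u. if u = b then q else p) B, UNIV)"
      by (rule H) (use b in auto)
    ultimately have "(B, restrict (\<lambda>_. p) B, UNIV :: 'e set)
        = (B, restrict (\<lambda>u. if u = b then q else p) B, UNIV)" using uniq by blast
    then have "restrict (\<lambda>_. p) B b = restrict (\<lambda>u. if u = b then q else p) B b" by simp
    then show False using pq b(1) by simp
  qed
next
  assume surj: "f ` A = B"
  define r where "r = inv_into A f"
  have r: "r b \<in> A" "f (r b) = b" if "b \<in> B" for b
    unfolding r_def using that surj by (auto simp: inv_into_into f_inv_into_f)
  show "strict_epi Ens (A, f, B)"
    unfolding strict_epi_def Ens_simps
  proof (intro conjI ballI impI)
    show "f \<in> A \<rightarrow>\<^sub>E B" by (fact m)
    fix Z :: "'e set" and g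
    assume "g \<in> hom Ens A Z"
    then obtain g' where g: "g = (A, g', Z)" "g' \<in> A \<rightarrow>\<^sub>E Z" unfolding hom_Ens by blast
    assume H: "\<forall>W \<in> UNIV. \<forall>s \<in> hom Ens W A. \<forall>t \<in> hom Ens W A.
        Comp Ens (A, f, B) s = Comp Ens (A, f, B) t \<longrightarrow> Comp Ens g s = Comp Ens g t"
    have resp: "g' a = g' a'" if aa: "a \<in> A" "a' \<in> A" "f a = f a'" for a a'
    proof -
      let ?s = "\<lambda>u. ({a}, restrict (\<lambda>_. u) {a}, A)"
      have "?s a \<in> hom Ens {a} A" "?s a' \<in> hom Ens {a} A" using aa by (auto simp: hom_Ens)
      moreover have "Comp Ens (A, f, B) (?s a) = Comp Ens (A, f, B) (?s a')"
        using aa by (simp add: compose_def fun_eq_iff)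
      ultimately have "Comp Ens g (?s a) = Comp Ens g (?s a')" using H by blast
      then have "compose {a} g' (restrict (\<lambda>_. a) {a}) a = compose {a} g' (restrict (\<lambda>_. a') {a}) a"
        unfolding g by simp
      then show ?thesis by (simp add: compose_def)
    qed
    show "\<exists>!h. h \<in> hom Ens B Z \<and> g = Comp Ens h (A, f, B)"
    proof (rule ex1I)
      let ?h = "restrict (g' \<circ> r) B"
      have h: "?h \<in> B \<rightarrow>\<^sub>E Z" using r g(2) by (auto simp: PiE_iff)
      have "f a \<in> B" "g' a = g' (r (f a))" if "a \<in> A" for a
        using resp[of a "r (f a)"] r[of "f a"] that surj by auto
      then show "(B, ?h, Z) \<in> hom Ens B Z \<and> g = Comp Ens (B, ?h, Z) (A, f, B)"
        unfolding g(1) Comp_Ens_eq_iff[OF m h g(2)] using h by (simp add: hom_Ens)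
      fix k assume k: "k \<in> hom Ens B Z \<and> g = Comp Ens k (A, f, B)"
      then obtain k' where k': "k = (B, k', Z)" "k' \<in> B \<rightarrow>\<^sub>E Z" unfolding hom_Ens by blast
      have eq: "\<forall>a \<in> A. g' a = k' (f a)"
        using k unfolding k'(1) g(1) Comp_Ens_eq_iff[OF m k'(2) g(2)] by blast
      have "k' b = ?h b" if "b \<in> B" for b
        using eq r[OF that] that by simp
      then have "k' = ?h" by (rule PiE_ext[OF k'(2) h])
      then show "k = (B, ?h, Z)" using k' by simp
    qed
  qed
qed

section \<open>Pro-objects and prorepresentable functors\<close>

record ('i, 'j, 'o, 'a) pro_data =
  Idx :: "('i, 'j) cat_data"
  Diag :: "('i, 'j, 'o, 'a) functor_data"

definition pro_object :: "('o, 'a) cat_data \<Rightarrow> ('i, 'j, 'o, 'a) pro_data \<Rightarrow> bool" where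
  "pro_object C P \<longleftrightarrow> cat_functor (Idx P) C (Diag P) \<and> cofiltered (Idx P)"

definition pro_reps :: "('o, 'a) cat_data \<Rightarrow> ('i, 'j, 'o, 'a) pro_data \<Rightarrow> 'o \<Rightarrow> ('i \<times> 'a) set" where
  "pro_reps C P X = {(i, u). i \<in> Obj (Idx P) \<and> u \<in> hom C (FOb (Diag P) i) X}"

definition pro_rel ::
  "('o, 'a) cat_data \<Rightarrow> ('i, 'j, 'o, 'a) pro_data \<Rightarrow> 'o \<Rightarrow> (('i \<times> 'a) \<times> ('i \<times> 'a)) set" where
  "pro_rel C P X = {((i, u), (j, v)). (i, u) \<in> pro_reps C P X \<and> (j, v) \<in> pro_reps C P X \<and>
    (\<exists>k \<in> Obj (Idx P). \<exists>a \<in> hom (Idx P) k i. \<exists>b \<in> hom (Idx P) k j.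
      Comp C u (FAr (Diag P) a) = Comp C v (FAr (Diag P) b))}"

text \<open>
  The functor \<open>[P,-]\<close>: the filtered colimit, over the opposite of the index category, of the
  representables \<open>hom C (P i) -\<close>, in its usual construction as a set of germs. An arrow
  \<open>x : P \<rightarrow> X\<close> is an element of \<open>[P,X]\<close>, and the composite \<open>f x\<close> with \<open>f : X \<rightarrow> Y\<close> is
  \<open>[P,f](x)\<close>.
\<close>

definition pro_hom ::
  "('o, 'a) cat_data \<Rightarrow> ('i, 'j, 'o, 'a) pro_data
    \<Rightarrow> ('o, 'a, ('i \<times> 'a) set set, ('i \<times> 'a) set ens_arr) functor_data" where
  "pro_hom C P = \<lparr>
    FOb = (\<lambda>X. pro_reps C P X // pro_rel C P X),
    FAr = (\<lambda>f.
      (pro_reps C P (Dom C f) // pro_rel C P (Dom C f),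
       \<lambda>c \<in> pro_reps C P (Dom C f) // pro_rel C P (Dom C f).
         pro_rel C P (Cod C f) `` {(i, Comp C f u) | i u. (i, u) \<in> c},
       pro_reps C P (Cod C f) // pro_rel C P (Cod C f)))\<rparr>"

lemma equiv_pro_rel:
  assumes "pro_object C P"
  shows "equiv (pro_reps C P X) (pro_rel C P X)"
proof -
  interpret cat_functor "Idx P" C "Diag P" using assms by (simp add: pro_object_def)
  have cof: "cofiltered (Idx P)" using assms by (simp add: pro_object_def)
  let ?p = "FAr (Diag P)"
  have hI: "f \<in> hom (Idx P) i j \<Longrightarrow> i \<in> Obj (Idx P) \<and> j \<in> Obj (Idx P)" for f i j
    unfolding hom_def using dom.dom_closed dom.cod_closed by blast
  show ?thesis
  proof (rule equivI)
    show "pro_rel C P X \<subseteq> pro_reps C P X \<times> pro_reps C P X"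
      by (auto simp: pro_rel_def)
    show "refl_on (pro_reps C P X) (pro_rel C P X)"
    proof (rule refl_onI)
      fix c assume c: "c \<in> pro_reps C P X"
      then obtain i u where "c = (i, u)" "i \<in> Obj (Idx P)" by (auto simp: pro_reps_def)
      then show "(c, c) \<in> pro_rel C P X"
        using c dom.ident_hom[of i] unfolding pro_rel_def by blast
    qed
    show "sym (pro_rel C P X)" by (rule symI) (auto simp: pro_rel_def, metis)
    show "trans (pro_rel C P X)"
    proof (rule transI)
      fix c1 c2 c3 assume "(c1, c2) \<in> pro_rel C P X" "(c2, c3) \<in> pro_rel C P X"
      then obtain i u j v l w k a b k' a' b' where
        c: "c1 = (i, u)" "c2 = (j, v)" "c3 = (l, w)"
          "(i, u) \<in> pro_reps C P X" "(j, v) \<in> pro_reps C P X" "(l, w) \<in> pro_reps C P X" and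
        k: "a \<in> hom (Idx P) k i" "b \<in> hom (Idx P) k j" "Comp C u (?p a) = Comp C v (?p b)" and
        k': "a' \<in> hom (Idx P) k' j" "b' \<in> hom (Idx P) k' l" "Comp C v (?p a') = Comp C w (?p b')"
        unfolding pro_rel_def by fast
      have uvw: "u \<in> hom C (FOb (Diag P) i) X" "v \<in> hom C (FOb (Diag P) j) X"
        "w \<in> hom C (FOb (Diag P) l) X" using c by (auto simp: pro_reps_def)
      obtain m d d' where d: "d \<in> hom (Idx P) m k" "d' \<in> hom (Idx P) m k'"
        using cof hI k(1) k'(1) unfolding cofiltered_def by blast
      have "Comp (Idx P) b d \<in> hom (Idx P) m j" "Comp (Idx P) a' d' \<in> hom (Idx P) m j"
        using d k k' dom.comp_hom by blast+
      moreover have "\<forall>x y f g. f \<in> hom (Idx P) x y \<longrightarrow> g \<in> hom (Idx P) x y \<longrightarrow>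
          (\<exists>n \<in> Obj (Idx P). \<exists>e \<in> hom (Idx P) n x. Comp (Idx P) f e = Comp (Idx P) g e)"
        using cof hI unfolding cofiltered_def by blast
      ultimately obtain n e where e: "n \<in> Obj (Idx P)" "e \<in> hom (Idx P) n m"
        "Comp (Idx P) (Comp (Idx P) b d) e = Comp (Idx P) (Comp (Idx P) a' d') e"
        by blast
      let ?d = "Comp (Idx P) d e" and ?d' = "Comp (Idx P) d' e"
      have de: "?d \<in> hom (Idx P) n k" "?d' \<in> hom (Idx P) n k'" using d e dom.comp_hom by blast+
      have eq: "Comp (Idx P) b ?d = Comp (Idx P) a' ?d'"
        using e(3) dom.comp_assoc[OF e(2) d(1) k(2)] dom.comp_assoc[OF e(2) d(2) k'(1)] by simp
      have pull: "Comp C x (?p (Comp (Idx P) f g)) = Comp C (Comp C x (?p f)) (?p g)"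
        if "x \<in> hom C (FOb (Diag P) i') X" "f \<in> hom (Idx P) j' i'" "g \<in> hom (Idx P) n j'" for x f g i' j'
        using cod.comp_assoc[OF ar_hom[OF that(3)] ar_hom[OF that(2)] that(1)] map_comp[OF that(3,2)]
        by simp
      have "Comp C u (?p (Comp (Idx P) a ?d)) = Comp C w (?p (Comp (Idx P) b' ?d'))"
        using pull[OF uvw(1) k(1) de(1)] pull[OF uvw(2) k(2) de(1)]
          pull[OF uvw(2) k'(1) de(2)] pull[OF uvw(3) k'(2) de(2)] k(3) k'(3) eq by simp
      moreover have "Comp (Idx P) a ?d \<in> hom (Idx P) n i" "Comp (Idx P) b' ?d' \<in> hom (Idx P) n l"
        using de k k' dom.comp_hom by blast+
      ultimately show "(c1, c3) \<in> pro_rel C P X"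
        using c e(1) unfolding pro_rel_def by blast
    qed
  qed
qed

lemma pro_hom_class:
  assumes P: "pro_object C P" and f: "f \<in> hom C X Y" and iu: "(i, u) \<in> pro_reps C P X"
  shows "ens_app (FAr (pro_hom C P) f) (pro_rel C P X `` {(i, u)})
    = pro_rel C P Y `` {(i, Comp C f u)}"
proof -
  interpret cat_functor "Idx P" C "Diag P" using P by (simp add: pro_object_def)
  have mv: "((i, Comp C f u), (j, Comp C f v)) \<in> pro_rel C P Y"
    if "((i, u), (j, v)) \<in> pro_rel C P X" for j v
  proof -
    from that obtain k a b where
      k: "k \<in> Obj (Idx P)" "a \<in> hom (Idx P) k i" "b \<in> hom (Idx P) k j"
        "Comp C u (FAr (Diag P) a) = Comp C v (FAr (Diag P) b)" and
      uv: "i \<in> Obj (Idx P)" "j \<in> Obj (Idx P)"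
        "u \<in> hom C (FOb (Diag P) i) X" "v \<in> hom C (FOb (Diag P) j) X"
      unfolding pro_rel_def pro_reps_def by blast
    have "Comp C (Comp C f u) (FAr (Diag P) a) = Comp C (Comp C f v) (FAr (Diag P) b)"
      using cod.comp_assoc[OF ar_hom[OF k(2)] uv(3) f] cod.comp_assoc[OF ar_hom[OF k(3)] uv(4) f] k(4)
      by simp
    then show ?thesis
      using k uv cod.comp_hom[OF uv(3) f] cod.comp_hom[OF uv(4) f]
      unfolding pro_rel_def pro_reps_def by blast
  qed
  have E: "equiv (pro_reps C P X) (pro_rel C P X)" "equiv (pro_reps C P Y) (pro_rel C P Y)"
    using equiv_pro_rel[OF P] by blast+
  let ?c = "pro_rel C P X `` {(i, u)}"
  have "?c \<in> pro_reps C P X // pro_rel C P X" using iu by (rule quotientI)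
  moreover have "pro_rel C P Y `` {(j, Comp C f v) | j v. (j, v) \<in> ?c}
      = pro_rel C P Y `` {(i, Comp C f u)}"
  proof -
    have "pro_rel C P Y `` {(j, Comp C f v)} = pro_rel C P Y `` {(i, Comp C f u)}"
      if "(j, v) \<in> ?c" for j v
      using equiv_class_eq[OF E(2) mv[of j v]] that by blast
    moreover have "(i, u) \<in> ?c" using equiv_class_self[OF E(1) iu] .
    ultimately show ?thesis by fast
  qed
  moreover have "Dom C f = X" "Cod C f = Y" using f by (auto simp: hom_def)
  ultimately show ?thesis by (simp add: pro_hom_def ens_app_def)
qed

lemma cat_functor_pro_hom:
  assumes P: "pro_object C P"
  shows "cat_functor C Ens (pro_hom C P)"
proof -
  interpret cat_functor "Idx P" C "Diag P" using P by (simp add: pro_object_def)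
  interpret E: category Ens by (rule category_Ens)
  let ?F = "pro_hom C P"
  have Ob: "FOb ?F X = pro_reps C P X // pro_rel C P X" for X by (simp add: pro_hom_def)
  have reps: "(i, Comp C f u) \<in> pro_reps C P Y"
    if "(i, u) \<in> pro_reps C P X" "f \<in> hom C X Y" for i u f X Y
    using that cod.comp_hom[of u _ X f Y] by (auto simp: pro_reps_def)
  have ar: "FAr ?F f = (FOb ?F X, ens_app (FAr ?F f), FOb ?F Y)"
    "ens_app (FAr ?F f) \<in> FOb ?F X \<rightarrow>\<^sub>E FOb ?F Y" if f: "f \<in> hom C X Y" for f X Y
  proof -
    have XY: "Dom C f = X" "Cod C f = Y" using f by (auto simp: hom_def)
    show "FAr ?F f = (FOb ?F X, ens_app (FAr ?F f), FOb ?F Y)"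
      using XY by (simp add: pro_hom_def ens_app_def)
    have "ens_app (FAr ?F f) c \<in> FOb ?F Y" if c: "c \<in> FOb ?F X" for c
    proof -
      obtain i u where iu: "c = pro_rel C P X `` {(i, u)}" "(i, u) \<in> pro_reps C P X"
        using c unfolding Ob by (auto elim!: quotientE)
      show ?thesis
        unfolding iu(1) pro_hom_class[OF P f iu(2)] Ob by (rule quotientI[OF reps[OF iu(2) f]])
    qed
    moreover have "ens_app (FAr ?F f) \<in> extensional (FOb ?F X)"
      using XY by (simp add: pro_hom_def ens_app_def)
    ultimately show "ens_app (FAr ?F f) \<in> FOb ?F X \<rightarrow>\<^sub>E FOb ?F Y" by (simp add: PiE_iff)
  qed
  show ?thesis
  proof
    show "FOb ?F X \<in> Obj Ens" for X by simp
    show "FAr ?F f \<in> hom Ens (FOb ?F X) (FOb ?F Y)" if "f \<in> hom C X Y" for f X Y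
      using ar[OF that] by (auto simp: hom_Ens)
    show "FAr ?F (Ident C X) = Ident Ens (FOb ?F X)" if X: "X \<in> Obj C" for X
    proof -
      note I = cod.ident_hom[OF X]
      have "ens_app (FAr ?F (Ident C X)) c = restrict id (FOb ?F X) c" if c: "c \<in> FOb ?F X" for c
      proof -
        obtain i u where iu: "c = pro_rel C P X `` {(i, u)}" "(i, u) \<in> pro_reps C P X"
          using c unfolding Ob by (auto elim!: quotientE)
        have "Comp C (Ident C X) u = u" using iu(2) cod.comp_ident_left by (auto simp: pro_reps_def)
        then show ?thesis using c pro_hom_class[OF P I iu(2)] iu(1) by simp
      qed
      then have "ens_app (FAr ?F (Ident C X)) = restrict id (FOb ?F X)"
        using PiE_ext[OF ar(2)[OF I], of "restrict id (FOb ?F X)"] by auto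
      then show ?thesis using ar(1)[OF I] by simp
    qed
    show "FAr ?F (Comp C g f) = Comp Ens (FAr ?F g) (FAr ?F f)"
      if f: "f \<in> hom C X Y" and g: "g \<in> hom C Y Z" for f g X Y Z
    proof -
      note gf = cod.comp_hom[OF f g]
      let ?k = "compose (FOb ?F X) (ens_app (FAr ?F g)) (ens_app (FAr ?F f))"
      have eq: "ens_app (FAr ?F (Comp C g f)) c = ?k c" if c: "c \<in> FOb ?F X" for c
      proof -
        obtain i u where iu: "c = pro_rel C P X `` {(i, u)}" "(i, u) \<in> pro_reps C P X"
          using c unfolding Ob by (auto elim!: quotientE)
        have "Comp C (Comp C g f) u = Comp C g (Comp C f u)"
          using iu(2) cod.comp_assoc[OF _ f g] by (auto simp: pro_reps_def)
        then show ?thesis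
          using c pro_hom_class[OF P gf iu(2)] pro_hom_class[OF P f iu(2)]
            pro_hom_class[OF P g reps[OF iu(2) f]] iu(1)
          by (simp add: compose_def)
      qed
      have k: "?k \<in> FOb ?F X \<rightarrow>\<^sub>E FOb ?F Z"
        using ar(2)[OF f] ar(2)[OF g] by (auto simp: compose_def PiE_iff)
      have "ens_app (FAr ?F (Comp C g f)) = ?k" by (rule PiE_ext[OF ar(2)[OF gf] k eq])
      then have "(FOb ?F X, ens_app (FAr ?F (Comp C g f)), FOb ?F Z)
          = Comp Ens (FOb ?F Y, ens_app (FAr ?F g), FOb ?F Z) (FOb ?F X, ens_app (FAr ?F f), FOb ?F Y)"
        by simp
      then show ?thesis unfolding ar(1)[OF gf, symmetric] ar(1)[OF g, symmetric] ar(1)[OF f, symmetric] .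
    qed
  qed
qed

section \<open>The localic group of automorphisms of a set-valued functor\<close>

type_synonym ('o, 'e) delta = "'o \<times> ('e \<times> 'e)"

definition D_Delta ::
  "('o, 'a) cat_data \<Rightarrow> ('o, 'a, 'e set, 'e ens_arr) functor_data \<Rightarrow> ('o, 'e) delta set" where
  "D_Delta C F = {(X, (x0, x1)). X \<in> Obj C \<and> x0 \<in> FOb F X \<and> x1 \<in> FOb F X}"

definition delta_le ::
  "('o, 'a) cat_data \<Rightarrow> ('o, 'a, 'e set, 'e ens_arr) functor_data
    \<Rightarrow> ('o, 'e) delta \<Rightarrow> ('o, 'e) delta \<Rightarrow> bool" where
  "delta_le C F = (\<lambda>(X, (x0, x1)) (Y, (y0, y1)).
    \<exists>f \<in> hom C X Y. ens_app (FAr F f) x0 = y0 \<and> ens_app (FAr F f) x1 = y1)"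

text \<open>
  The free inf-lattice on the preorder above, kept as a preorder: an object \<open>[A]\<close> is represented
  by the finite set \<open>A\<close> itself, the infimum is the union and the top element is the empty set.
\<close>

definition inf_obj ::
  "('o, 'a) cat_data \<Rightarrow> ('o, 'a, 'e set, 'e ens_arr) functor_data \<Rightarrow> ('o, 'e) delta set set" where
  "inf_obj C F = {A. A \<subseteq> D_Delta C F \<and> finite A}"

definition inf_le ::
  "('o, 'a) cat_data \<Rightarrow> ('o, 'a, 'e set, 'e ens_arr) functor_data
    \<Rightarrow> ('o, 'e) delta set \<Rightarrow> ('o, 'e) delta set \<Rightarrow> bool" where
  "inf_le C F A B \<longleftrightarrow> (\<forall>b \<in> B. \<exists>a \<in> A. delta_le C F a b)"

text \<open>
  \<open>covers C F u U\<close>: the family of objects \<open>U\<close> covers the object \<open>u\<close>. Arrows are unique in a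
  preorder, so a covering family is determined by the set of its sources. The generator
  \<open><x0|x1>\<close> at \<open>X\<close> stands for the automorphisms sending \<open>x0\<close> to \<open>x1\<close>.
\<close>

inductive covers ::
  "('o, 'a) cat_data \<Rightarrow> ('o, 'a, 'e set, 'e ens_arr) functor_data
    \<Rightarrow> ('o, 'e) delta set \<Rightarrow> ('o, 'e) delta set set \<Rightarrow> bool"
  for C :: "('o, 'a) cat_data" and F :: "('o, 'a, 'e set, 'e ens_arr) functor_data"
  where
    functional: "\<lbrakk>X \<in> Obj C; z \<in> FOb F X; x \<in> FOb F X; y \<in> FOb F X; x \<noteq> y\<rbrakk>
      \<Longrightarrow> covers C F {(X, (z, x)), (X, (z, y))} {}"
  | injective: "\<lbrakk>X \<in> Obj C; z \<in> FOb F X; x \<in> FOb F X; y \<in> FOb F X; x \<noteq> y\<rbrakk>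
      \<Longrightarrow> covers C F {(X, (x, z)), (X, (y, z))} {}"
  | surjective: "\<lbrakk>X \<in> Obj C; z \<in> FOb F X\<rbrakk>
      \<Longrightarrow> covers C F {} {{(X, (x, z))} | x. x \<in> FOb F X}"
  | total: "\<lbrakk>X \<in> Obj C; z \<in> FOb F X\<rbrakk>
      \<Longrightarrow> covers C F {} {{(X, (z, x))} | x. x \<in> FOb F X}"
  | isomorphism: "\<lbrakk>u \<in> inf_obj C F; v \<in> inf_obj C F; inf_le C F u v; inf_le C F v u\<rbrakk>
      \<Longrightarrow> covers C F u {v}"
  | pullback: "\<lbrakk>covers C F u U; v \<in> inf_obj C F\<rbrakk>
      \<Longrightarrow> covers C F (u \<union> v) ((\<lambda>w. w \<union> v) ` U)"
  | composition: "\<lbrakk>covers C F u U; \<And>w. w \<in> U \<Longrightarrow> covers C F w (V w)\<rbrakk>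
      \<Longrightarrow> covers C F u (\<Union>w \<in> U. V w)"

lemma covers_inf_obj: "covers C F u U \<Longrightarrow> u \<in> inf_obj C F \<and> U \<subseteq> inf_obj C F"
proof (induction rule: covers.induct)
  case (composition u U V)
  then show ?case by blast
qed (auto simp: inf_obj_def D_Delta_def)

text \<open>The elements of the locale \<open>lAut(F)\<close>; its order is inclusion.\<close>

definition lAut ::
  "('o, 'a) cat_data \<Rightarrow> ('o, 'a, 'e set, 'e ens_arr) functor_data
    \<Rightarrow> ('o, 'e) delta set set set" where
  "lAut C F = {T. T \<subseteq> inf_obj C F \<and>
    (\<forall>u \<in> T. \<forall>v \<in> inf_obj C F. inf_le C F v u \<longrightarrow> v \<in> T) \<and>
    (\<forall>u U. covers C F u U \<longrightarrow> U \<subseteq> T \<longrightarrow> u \<in> T)}"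

definition assoc_sheaf ::
  "('o, 'a) cat_data \<Rightarrow> ('o, 'a, 'e set, 'e ens_arr) functor_data
    \<Rightarrow> ('o, 'e) delta set \<Rightarrow> ('o, 'e) delta set set" where
  "assoc_sheaf C F u = \<Inter>{T \<in> lAut C F. u \<in> T}"

definition lFix ::
  "('o, 'a) cat_data \<Rightarrow> ('o, 'a, 'e set, 'e ens_arr) functor_data
    \<Rightarrow> 'o \<Rightarrow> 'e \<Rightarrow> ('o, 'e) delta set set" where
  "lFix C F X x = assoc_sheaf C F {(X, (x, x))}"

text \<open>
  For \<open>F = [P,-]\<close>: the arrow \<open>x : P \<rightarrow> X\<close> is the categorical quotient, relative to \<open>C\<close>, of \<open>P\<close>
  by \<open>lFix(x)\<close>; an arrow \<open>y\<close> out of \<open>P\<close> is invariant under \<open>lFix(x)\<close> when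
  \<open>lFix(x) \<le> lFix(y)\<close>.
\<close>

definition is_categorical_quotient ::
  "('o, 'a) cat_data \<Rightarrow> ('i, 'j, 'o, 'a) pro_data \<Rightarrow> 'o \<Rightarrow> ('i \<times> 'a) set \<Rightarrow> bool" where
  "is_categorical_quotient C P X x \<longleftrightarrow>
    (\<forall>Y \<in> Obj C. \<forall>y \<in> FOb (pro_hom C P) Y.
      lFix C (pro_hom C P) X x \<subseteq> lFix C (pro_hom C P) Y y \<longrightarrow>
      (\<exists>!f. f \<in> hom C X Y \<and> ens_app (FAr (pro_hom C P) f) x = y))"

end

theory Submission
  imports Defs
begin

text \<open>
  An arrow \<open>f : X \<rightarrow> Y\<close> with \<open>f x = y\<close> is produced by descent. Since the diagram of \<open>F\<close> is
  cofiltered, some \<open>(Z, z)\<close> maps to both \<open>(X, x)\<close> and \<open>(Y, y)\<close>, by \<open>p : Z \<rightarrow> X\<close> and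
  \<open>q : Z \<rightarrow> Y\<close> say. As \<open>p\<close> is a strict epimorphism, \<open>q\<close> factors through \<open>p\<close> provided that
  \<open>p s = p t\<close> implies \<open>q s = q t\<close>, and the factor then takes \<open>x\<close> to \<open>y\<close>. Let \<open>p s = p t\<close>. The
  map \<open>F s\<close> is surjective, so \<open>z = s w\<close> for some \<open>w\<close>; put \<open>z' = t w\<close>. An automorphism that takes
  \<open>z\<close> to \<open>z'\<close> takes \<open>x = p z\<close> to \<open>p z' = x\<close>, hence lies in \<open>lFix(x)\<close>, hence fixes \<open>y\<close>. On the
  other hand it takes \<open>y = q z\<close> to \<open>q z'\<close>. So \<open>q (s w) = y = q z' = q (t w)\<close>, and because
  arrows of \<open>C\<close> are determined by their value at a single element (lemma \<open>arrow_unique\<close>),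
  \<open>q s = q t\<close>.

  This argument speaks of automorphisms, of which there may be none: what it needs is that
  \<open>[(Z,<z|z'>)]\<close> is not the zero of the locale \<open>lAut(F)\<close>, although that locale may fail to have
  points. The reason is that the singletons form a dense part of the site in the following sense
  (lemma \<open>cover_refines_singleton\<close>): whenever a family covers an object above a singleton, some
  smaller singleton lies below a member of the family. In particular the empty family covers
  no singleton. The property is immediate to transport along the closure rules for covers.
  For the functionality and injectivity covers it expresses that arrows are determined by one
  value; for the totality and surjectivity covers it combines cofilteredness with the surjectivity
  of all the maps \<open>F f\<close>.

  The density turns into a statement on sheaves through the pseudocomplements: the objects
  having no singleton below them in common with a given \<open>d\<close> form a sheaf. Applied to
  \<open>d = [(Y,<y|q z'>)]\<close> this sheaf contains \<open>[(Y,<y|y>)]\<close> unless \<open>q z' = y\<close>, hence it contains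
  \<open>lFix(y)\<close>, hence \<open>[(Z,<z|z'>)]\<close>, which however lies below \<open>d\<close>.
\<close>

section \<open>Set-valued functors with cofiltered diagram\<close>

text \<open>
  The last two conditions come from cofilteredness of the diagram of \<open>F\<close>: the first is the
  existence of a common source for two objects \<open>(X, x)\<close> and \<open>(Y, y)\<close>, and \<open>equalized\<close> retains of
  the existence of equalizing arrows what concerns \<open>C\<close>. The condition \<open>surj\<close> is the meaning of
  preservation of strict epimorphisms when all arrows are strict epimorphisms.
\<close>

locale galois_functor = cat_functor C Ens F
  for C :: "('o, 'a) cat_data" and F :: "('o, 'a, 'e set, 'e ens_arr) functor_data" +
  assumes strict: "f \<in> Arr C \<Longrightarrow> strict_epi C f"
    and surj: "f \<in> hom C X Y \<Longrightarrow> ens_app (FAr F f) ` FOb F X = FOb F Y"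
    and common_source: "\<lbrakk>X \<in> Obj C; Y \<in> Obj C; x \<in> FOb F X; y \<in> FOb F Y\<rbrakk> \<Longrightarrow>
      \<exists>Z \<in> Obj C. \<exists>z \<in> FOb F Z. \<exists>f \<in> hom C Z X. \<exists>g \<in> hom C Z Y.
        ens_app (FAr F f) z = x \<and> ens_app (FAr F g) z = y"
    and equalized: "\<lbrakk>f \<in> hom C X Y; g \<in> hom C X Y; x \<in> FOb F X;
        ens_app (FAr F f) x = ens_app (FAr F g) x\<rbrakk> \<Longrightarrow>
      \<exists>Z \<in> Obj C. \<exists>e \<in> hom C Z X. Comp C f e = Comp C g e"
begin

abbreviation act :: "'a \<Rightarrow> 'e \<Rightarrow> 'e" where
  "act f \<equiv> ens_app (FAr F f)"

lemma hom_obj: "f \<in> hom C X Y \<Longrightarrow> X \<in> Obj C \<and> Y \<in> Obj C"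
  using dom.dom_closed dom.cod_closed by (auto simp: hom_def)

lemma act_in: "f \<in> hom C X Y \<Longrightarrow> x \<in> FOb F X \<Longrightarrow> act f x \<in> FOb F Y"
  using surj by blast

lemma act_onto:
  assumes f: "f \<in> hom C X Y" and y: "y \<in> FOb F Y"
  obtains x where "x \<in> FOb F X" "act f x = y"
proof -
  have "y \<in> act f ` FOb F X" using surj[OF f] y by simp
  then show ?thesis using that by (elim imageE) simp
qed

lemma act_ident: "X \<in> Obj C \<Longrightarrow> x \<in> FOb F X \<Longrightarrow> act (Ident C X) x = x"
  by (simp add: map_ident ens_app_def)

lemma act_comp:
  assumes "f \<in> hom C X Y" "g \<in> hom C Y Z" "x \<in> FOb F X"
  shows "act (Comp C g f) x = act g (act f x)"
proof -
  obtain f' where "FAr F f = (FOb F X, f', FOb F Y)"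
    using ar_hom[OF assms(1)] by (auto simp: hom_Ens)
  moreover obtain g' where "FAr F g = (FOb F Y, g', FOb F Z)"
    using ar_hom[OF assms(2)] by (auto simp: hom_Ens)
  ultimately show ?thesis
    using assms(3) by (simp add: map_comp[OF assms(1,2)] ens_app_def compose_def)
qed

lemma strict_epi_cancel:
  assumes e: "e \<in> hom C Z X" and fg: "f \<in> hom C X Y" "g \<in> hom C X Y"
    and eq: "Comp C f e = Comp C g e"
  shows "f = g"
proof -
  have e': "Dom C e = Z" "Cod C e = X" "strict_epi C e" using e strict by (auto simp: hom_def)
  have fe: "Comp C f e \<in> hom C Z Y" using dom.comp_hom[OF e fg(1)] .
  have "Comp C (Comp C f e) s = Comp C (Comp C f e) t"
    if "s \<in> hom C W Z" "t \<in> hom C W Z" "Comp C e s = Comp C e t" for W s t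
    using dom.comp_assoc[OF that(1) e fg(1)] dom.comp_assoc[OF that(2) e fg(1)] that(3) by simp
  then have "\<exists>!h. h \<in> hom C X Y \<and> Comp C f e = Comp C h e"
    using e'(3) fe hom_obj[OF fg(1)] unfolding strict_epi_def e'(1,2) by blast
  then show ?thesis using fg eq by blast
qed

text \<open>
  Two arrows with the same value at an element are equalized by some arrow, which is an
  epimorphism.
\<close>

lemma arrow_unique:
  assumes "f \<in> hom C X Y" "g \<in> hom C X Y" "x \<in> FOb F X" "act f x = act g x"
  shows "f = g"
  using equalized[OF assms] strict_epi_cancel assms(1,2) by blast

section \<open>Density of the singletons\<close>

lemma delta_le_iff [simp]:
  "delta_le C F (X, (x, x')) (Y, (y, y')) \<longleftrightarrow> (\<exists>f \<in> hom C X Y. act f x = y \<and> act f x' = y')"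
  by (simp add: delta_le_def)

lemma delta_le_refl: "d \<in> D_Delta C F \<Longrightarrow> delta_le C F d d"
  using dom.ident_hom act_ident by (fastforce simp: D_Delta_def)

lemma delta_le_trans:
  assumes d: "d \<in> D_Delta C F" and le: "delta_le C F d e" "delta_le C F e e'"
  shows "delta_le C F d e'"
proof -
  obtain X x x' Y y y' Z z z' where
    t: "d = (X, (x, x'))" "e = (Y, (y, y'))" "e' = (Z, (z, z'))"
    by (metis prod.exhaust)
  obtain f g where fg: "f \<in> hom C X Y" "g \<in> hom C Y Z"
    "act f x = y" "act f x' = y'" "act g y = z" "act g y' = z'"
    using le unfolding t by auto
  have "x \<in> FOb F X" "x' \<in> FOb F X" using d by (auto simp: t D_Delta_def)
  then have "act (Comp C g f) x = z" "act (Comp C g f) x' = z'"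
    using act_comp[OF fg(1,2)] fg(3-6) by auto
  then show ?thesis
    unfolding t delta_le_iff using dom.comp_hom[OF fg(1,2)] by blast
qed

definition below :: "('o, 'e) delta \<Rightarrow> ('o, 'e) delta set \<Rightarrow> bool" where
  "below d u \<longleftrightarrow> d \<in> D_Delta C F \<and> (\<forall>b \<in> u. delta_le C F d b)"

lemma below_singleton: "below d {b} \<longleftrightarrow> d \<in> D_Delta C F \<and> delta_le C F d b"
  by (simp add: below_def)

lemma below_Un: "below d (u \<union> v) \<longleftrightarrow> below d u \<and> below d v"
  by (auto simp: below_def)

lemma below_trans: "below e {d} \<Longrightarrow> below d u \<Longrightarrow> below e u"
  using delta_le_trans unfolding below_def by blast

lemma below_inf_le: "below d u \<Longrightarrow> inf_le C F u v \<Longrightarrow> below d v"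
  using delta_le_trans unfolding below_def inf_le_def by blast

text \<open>
  An element of \<open>F Z\<close> and one of \<open>F X\<close> come from a common \<open>(W, w)\<close> by cofilteredness. A second
  element of \<open>F Z\<close> can then be lifted to \<open>F W\<close>, because \<open>F W \<rightarrow> F Z\<close> is surjective, and pushed
  forward to \<open>F X\<close>. This is the localic shadow of the fact that an automorphism is defined
  everywhere and surjective.
\<close>

lemma extend_pair:
  assumes Z: "Z \<in> Obj C" "z \<in> FOb F Z" "z' \<in> FOb F Z" and X: "X \<in> Obj C" "x \<in> FOb F X"
  obtains W w w' h f where "W \<in> Obj C" "w \<in> FOb F W" "w' \<in> FOb F W"
    "h \<in> hom C W Z" "f \<in> hom C W X" "act h w = z" "act h w' = z'" "act f w = x"
proof -
  obtain W w h f where W: "W \<in> Obj C" "w \<in> FOb F W" "h \<in> hom C W Z" "f \<in> hom C W X"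
    "act h w = z" "act f w = x"
    using common_source[OF Z(1) X(1) Z(2) X(2)] by blast
  moreover obtain w' where "w' \<in> FOb F W" "act h w' = z'"
    using act_onto[OF W(3) Z(3)] .
  ultimately show ?thesis using that by blast
qed

lemma not_below_distinct_values:
  assumes "below d {(X, (z, x)), (X, (z, y))}"
  shows "x = y"
proof -
  obtain W w w' where d: "d = (W, (w, w'))" "w \<in> FOb F W"
    using assms by (auto simp: below_def D_Delta_def)
  then obtain f g where "f \<in> hom C W X" "g \<in> hom C W X"
    "act f w = z" "act g w = z" "act f w' = x" "act g w' = y"
    using assms by (auto simp: below_def)
  then show ?thesis using arrow_unique[of f W X g w] d(2) by simp
qed

lemma not_below_distinct_arguments:
  assumes "below d {(X, (x, z)), (X, (y, z))}"
  shows "x = y"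
proof -
  obtain W w w' where d: "d = (W, (w, w'))" "w' \<in> FOb F W"
    using assms by (auto simp: below_def D_Delta_def)
  then obtain f g where "f \<in> hom C W X" "g \<in> hom C W X"
    "act f w' = z" "act g w' = z" "act f w = x" "act g w = y"
    using assms by (auto simp: below_def)
  then show ?thesis using arrow_unique[of f W X g w'] d(2) by simp
qed

text \<open>
  The passage to a smaller \<open>e\<close> is what makes the property stable under composition and what the
  totality and surjectivity covers require: \<open>d\<close> itself need not decide the value at \<open>z\<close>.
  Stability under pullback holds because \<open>e\<close> stays below everything that \<open>d\<close> is below.
\<close>

lemma cover_refines_singleton:
  assumes "covers C F u U" "below d u"
  shows "\<exists>w \<in> U. \<exists>e. below e {d} \<and> below e w"
  using assms
proof (induction arbitrary: d)
  case (functional X z x y)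
  then show ?case using not_below_distinct_values by blast
next
  case (injective X z x y)
  then show ?case using not_below_distinct_arguments by blast
next
  case (surjective X z)
  obtain Z a a' where d: "d = (Z, (a, a'))" "Z \<in> Obj C" "a \<in> FOb F Z" "a' \<in> FOb F Z"
    using surjective by (auto simp: below_def D_Delta_def)
  obtain W w' w h f where W: "W \<in> Obj C" "w' \<in> FOb F W" "w \<in> FOb F W"
    "h \<in> hom C W Z" "f \<in> hom C W X" "act h w' = a'" "act h w = a" "act f w' = z"
    by (rule extend_pair[OF d(2,4,3) surjective.hyps])
  have "below (W, (w, w')) {d}" "below (W, (w, w')) {(X, (act f w, z))}"
    using W d(1) by (auto simp: below_singleton D_Delta_def)
  then show ?case using act_in[OF W(5,3)] by blast
next
  case (total X z)
  obtain Z a a' where d: "d = (Z, (a, a'))" "Z \<in> Obj C" "a \<in> FOb F Z" "a' \<in> FOb F Z"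
    using total by (auto simp: below_def D_Delta_def)
  obtain W w w' h f where W: "W \<in> Obj C" "w \<in> FOb F W" "w' \<in> FOb F W"
    "h \<in> hom C W Z" "f \<in> hom C W X" "act h w = a" "act h w' = a'" "act f w = z"
    by (rule extend_pair[OF d(2,3,4) total.hyps])
  have "below (W, (w, w')) {d}" "below (W, (w, w')) {(X, (z, act f w'))}"
    using W d(1) by (auto simp: below_singleton D_Delta_def)
  then show ?case using act_in[OF W(5,3)] by blast
next
  case (isomorphism u v)
  then have "below d v" using below_inf_le by blast
  moreover have "below d {d}"
    using isomorphism.prems delta_le_refl by (simp add: below_def)
  ultimately show ?case by blast
next
  case (pullback u U v)
  then have d: "below d u" "below d v" by (simp_all add: below_Un)
  obtain w e where w: "w \<in> U" "below e {d}" "below e w"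
    using pullback.IH[OF d(1)] by blast
  then have "below e (w \<union> v)" using below_trans[OF w(2) d(2)] by (simp add: below_Un)
  then show ?case using w(2) by (intro bexI[OF _ imageI[OF w(1)]]) blast
next
  case (composition u U V)
  then obtain w e where w: "w \<in> U" "below e {d}" "below e w" by blast
  with composition.IH(2) obtain v e' where "v \<in> V w" "below e' {e}" "below e' v" by blast
  then show ?case using below_trans w by blast
qed

text \<open>
  As soon as some \<open>F X\<close> is nonempty, this is the pseudocomplement of \<open>#v\<close> in \<open>lAut(F)\<close>, described
  by singletons alone.
\<close>

definition apart_from :: "('o, 'e) delta set \<Rightarrow> ('o, 'e) delta set set" where
  "apart_from v = {u \<in> inf_obj C F. \<nexists>d. below d u \<and> below d v}"

lemma apart_from_sheaf: "apart_from v \<in> lAut C F"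
proof -
  have "u \<in> apart_from v" if cov: "covers C F u U" and U: "U \<subseteq> apart_from v" for u U
  proof -
    have False if "below d u" "below d v" for d
    proof -
      obtain w e where w: "w \<in> U" "below e {d}" "below e w"
        using cover_refines_singleton[OF cov \<open>below d u\<close>] by blast
      then show False using U below_trans[OF w(2) \<open>below d v\<close>] unfolding apart_from_def by blast
    qed
    then show ?thesis using covers_inf_obj[OF cov] by (auto simp: apart_from_def)
  qed
  moreover have "u' \<in> apart_from v"
    if "u \<in> apart_from v" "u' \<in> inf_obj C F" "inf_le C F u' u" for u u'
    using that below_inf_le unfolding apart_from_def by blast
  ultimately show ?thesis
    unfolding lAut_def using apart_from_def by blast
qed

section \<open>The Lifting Lemma\<close>

text \<open>
  If every automorphism fixing \<open>x\<close> fixes \<open>y\<close>, then one that takes \<open>z\<close> to \<open>z'\<close> and fixes the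
  image \<open>x\<close> of \<open>z\<close> also fixes the image \<open>y\<close> of \<open>z\<close>. In the locale, \<open>z\<close> and \<open>z'\<close> alone play the
  part of such an automorphism.
\<close>

lemma lFix_le_same_image:
  assumes p: "p \<in> hom C Z X" and q: "q \<in> hom C Z Y"
    and z: "z \<in> FOb F Z" "z' \<in> FOb F Z" and pz: "act p z = act p z'"
    and le: "lFix C F X (act p z) \<subseteq> lFix C F Y (act q z)"
  shows "act q z = act q z'"
proof (rule ccontr)
  assume neq: "act q z \<noteq> act q z'"
  let ?zz = "(Z, (z, z'))"
  let ?T = "apart_from {(Y, (act q z, act q z'))}"
  have zz: "?zz \<in> D_Delta C F" using hom_obj[OF p] z by (simp add: D_Delta_def)
  have "{(Y, (act q z, act q z))} \<in> inf_obj C F"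
    using hom_obj[OF q] act_in[OF q] z by (simp add: inf_obj_def D_Delta_def)
  then have "{(Y, (act q z, act q z))} \<in> ?T"
    using neq not_below_distinct_values[of _ Y "act q z" "act q z" "act q z'"]
    unfolding apart_from_def below_def by blast
  then have "lFix C F X (act p z) \<subseteq> ?T"
    using le apart_from_sheaf unfolding lFix_def assoc_sheaf_def by blast
  moreover have "{?zz} \<in> lFix C F X (act p z)"
    unfolding lFix_def assoc_sheaf_def
  proof (rule InterI)
    fix T assume T: "T \<in> {T \<in> lAut C F. {(X, (act p z, act p z))} \<in> T}"
    have "inf_le C F {?zz} {(X, (act p z, act p z))}" using p pz by (auto simp: inf_le_def)
    moreover have "{?zz} \<in> inf_obj C F" using zz by (simp add: inf_obj_def)
    ultimately show "{?zz} \<in> T" using T unfolding lAut_def by blast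
  qed
  ultimately have "{?zz} \<in> ?T" by blast
  moreover have "below ?zz {?zz}" "below ?zz {(Y, (act q z, act q z'))}"
    using zz delta_le_refl[OF zz] q by (auto simp: below_def)
  ultimately show False by (auto simp: apart_from_def)
qed

theorem lifting:
  assumes XY: "X \<in> Obj C" "Y \<in> Obj C" and x: "x \<in> FOb F X" and y: "y \<in> FOb F Y"
    and le: "lFix C F X x \<subseteq> lFix C F Y y"
  shows "\<exists>!f. f \<in> hom C X Y \<and> act f x = y"
proof (rule ex_ex1I)
  obtain Z z p q where Z: "Z \<in> Obj C" "z \<in> FOb F Z" "p \<in> hom C Z X" "q \<in> hom C Z Y"
    "act p z = x" "act q z = y"
    using common_source[OF XY x y] by blast
  have p: "strict_epi C p" "Dom C p = Z" "Cod C p = X"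
    using Z(3) strict by (auto simp: hom_def)
  have "Comp C q s = Comp C q t"
    if st: "s \<in> hom C W Z" "t \<in> hom C W Z" and ps: "Comp C p s = Comp C p t" for W s t
  proof -
    obtain w where w: "w \<in> FOb F W" "act s w = z" using act_onto[OF st(1) Z(2)] .
    have tw: "act t w \<in> FOb F Z" using act_in[OF st(2) w(1)] .
    have "act p z = act p (act t w)"
      using act_comp[OF st(1) Z(3) w(1)] act_comp[OF st(2) Z(3) w(1)] ps w(2) by simp
    then have "act q z = act q (act t w)"
      using lFix_le_same_image[OF Z(3,4,2) tw] le Z(5,6) by simp
    then have "act (Comp C q s) w = act (Comp C q t) w"
      using act_comp[OF st(1) Z(4) w(1)] act_comp[OF st(2) Z(4) w(1)] w(2) by simp
    then show ?thesis
      using arrow_unique dom.comp_hom[OF st(1) Z(4)] dom.comp_hom[OF st(2) Z(4)] w(1) by blast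
  qed
  then obtain f where f: "f \<in> hom C X Y" "q = Comp C f p"
    using p(1) XY(2) Z(4) unfolding strict_epi_def p(2,3) by blast
  then have "act f x = y" using act_comp[OF Z(3) f(1) Z(2)] Z(5,6) by simp
  then show "\<exists>f. f \<in> hom C X Y \<and> act f x = y" using f(1) by blast
next
  fix f g assume "f \<in> hom C X Y \<and> act f x = y" "g \<in> hom C X Y \<and> act g x = y"
  then show "f = g" using arrow_unique[of f X Y g x] x by simp
qed

end

section \<open>Cofilteredness for pro-objects\<close>

text \<open>
  Every germ is the value of an arrow of \<open>C\<close> at the projection \<open>P \<rightarrow> P k\<close>, which is the germ of
  the identity of \<open>P k\<close>. The index \<open>k\<close> is free to lie over that of a given representative, so that
  two germs can be treated with the same \<open>k\<close>.
\<close>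

lemma pro_hom_germ_from_projection:
  assumes P: "pro_object C P" and iu: "(i, u) \<in> pro_reps C P X" and a: "a \<in> hom (Idx P) k i"
  defines "Q \<equiv> FOb (Diag P) k" and "r \<equiv> Comp C u (FAr (Diag P) a)"
  defines "z \<equiv> pro_rel C P Q `` {(k, Ident C Q)}"
  shows "Q \<in> Obj C" "z \<in> FOb (pro_hom C P) Q" "r \<in> hom C Q X"
    "ens_app (FAr (pro_hom C P) r) z = pro_rel C P X `` {(i, u)}"
proof -
  interpret cat_functor "Idx P" C "Diag P" using P by (simp add: pro_object_def)
  have k: "k \<in> Obj (Idx P)" using a dom.dom_closed by (auto simp: hom_def)
  then show Q: "Q \<in> Obj C" unfolding Q_def by (rule ob_closed)
  note I = cod.ident_hom[OF Q]
  have kI: "(k, Ident C Q) \<in> pro_reps C P Q" using k I by (simp add: pro_reps_def Q_def)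
  then show "z \<in> FOb (pro_hom C P) Q" unfolding z_def by (simp add: pro_hom_def quotientI)
  show r: "r \<in> hom C Q X"
    unfolding r_def Q_def using cod.comp_hom[OF ar_hom[OF a]] iu by (simp add: pro_reps_def)
  have "Comp C r (FAr (Diag P) (Ident (Idx P) k)) = r"
    using map_ident[OF k] cod.comp_ident_right[OF r] by (simp add: Q_def)
  moreover have "(k, r) \<in> pro_reps C P X" using k r by (simp add: pro_reps_def Q_def)
  ultimately have "((k, r), (i, u)) \<in> pro_rel C P X"
    using dom.ident_hom[OF k] a iu k unfolding pro_rel_def r_def by fastforce
  then have "pro_rel C P X `` {(k, r)} = pro_rel C P X `` {(i, u)}"
    using equiv_class_eq[OF equiv_pro_rel[OF P]] by blast
  then show "ens_app (FAr (pro_hom C P) r) z = pro_rel C P X `` {(i, u)}"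
    unfolding z_def pro_hom_class[OF P r kI] cod.comp_ident_right[OF r] .
qed

lemma pro_hom_germ:
  assumes "x \<in> FOb (pro_hom C P) X"
  obtains i u where "(i, u) \<in> pro_reps C P X" "x = pro_rel C P X `` {(i, u)}"
  using assms by (auto simp: pro_hom_def elim!: quotientE)

lemma pro_hom_common_source:
  assumes P: "pro_object C P" and x: "x \<in> FOb (pro_hom C P) X" and y: "y \<in> FOb (pro_hom C P) Y"
  shows "\<exists>Z \<in> Obj C. \<exists>z \<in> FOb (pro_hom C P) Z. \<exists>f \<in> hom C Z X. \<exists>g \<in> hom C Z Y.
    ens_app (FAr (pro_hom C P) f) z = x \<and> ens_app (FAr (pro_hom C P) g) z = y"
proof -
  obtain i u where iu: "(i, u) \<in> pro_reps C P X" "x = pro_rel C P X `` {(i, u)}"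
    using pro_hom_germ[OF x] .
  obtain j v where jv: "(j, v) \<in> pro_reps C P Y" "y = pro_rel C P Y `` {(j, v)}"
    using pro_hom_germ[OF y] .
  have "i \<in> Obj (Idx P)" "j \<in> Obj (Idx P)" using iu(1) jv(1) by (auto simp: pro_reps_def)
  then obtain k a b where ab: "a \<in> hom (Idx P) k i" "b \<in> hom (Idx P) k j"
    using P unfolding pro_object_def cofiltered_def by blast
  show ?thesis
    using pro_hom_germ_from_projection[OF P iu(1) ab(1)]
      pro_hom_germ_from_projection[OF P jv(1) ab(2)] iu(2) jv(2) by blast
qed

lemma pro_hom_equalized:
  assumes P: "pro_object C P" and f: "f \<in> hom C X Y" and g: "g \<in> hom C X Y"
    and x: "x \<in> FOb (pro_hom C P) X"
    and eq: "ens_app (FAr (pro_hom C P) f) x = ens_app (FAr (pro_hom C P) g) x"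
  shows "\<exists>Z \<in> Obj C. \<exists>e \<in> hom C Z X. Comp C f e = Comp C g e"
proof -
  interpret cat_functor "Idx P" C "Diag P" using P by (simp add: pro_object_def)
  let ?p = "FAr (Diag P)"
  obtain i u where iu: "(i, u) \<in> pro_reps C P X" "x = pro_rel C P X `` {(i, u)}"
    using pro_hom_germ[OF x] .
  have u: "u \<in> hom C (FOb (Diag P) i) X" and i: "i \<in> Obj (Idx P)"
    using iu(1) by (auto simp: pro_reps_def)
  have "(i, Comp C g u) \<in> pro_reps C P Y"
    using i cod.comp_hom[OF u g] by (simp add: pro_reps_def)
  moreover have "pro_rel C P Y `` {(i, Comp C f u)} = pro_rel C P Y `` {(i, Comp C g u)}"
    using eq unfolding iu(2) pro_hom_class[OF P f iu(1)] pro_hom_class[OF P g iu(1)] .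
  ultimately have "((i, Comp C f u), (i, Comp C g u)) \<in> pro_rel C P Y"
    using eq_equiv_class[OF _ equiv_pro_rel[OF P]] by blast
  then obtain k a b where k: "k \<in> Obj (Idx P)" "a \<in> hom (Idx P) k i" "b \<in> hom (Idx P) k i"
    "Comp C (Comp C f u) (?p a) = Comp C (Comp C g u) (?p b)"
    unfolding pro_rel_def by blast
  (* The germs agree after two possibly different transition arrows, which are equalized in turn. *)
  obtain n d where d: "d \<in> hom (Idx P) n k" "Comp (Idx P) a d = Comp (Idx P) b d"
    using P i k(1-3) unfolding pro_object_def cofiltered_def by blast
  let ?e = "Comp C u (?p (Comp (Idx P) a d))"
  have pull: "Comp C h (Comp C u (?p (Comp (Idx P) c d))) = Comp C (Comp C (Comp C h u) (?p c)) (?p d)"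
    if h: "h \<in> hom C X Y" and c: "c \<in> hom (Idx P) k i" for h c
    using map_comp[OF d(1) c] cod.comp_hom[OF ar_hom[OF d(1)] ar_hom[OF c]]
      cod.comp_assoc[OF ar_hom[OF d(1)] ar_hom[OF c] cod.comp_hom[OF u h]]
      cod.comp_assoc[OF cod.comp_hom[OF ar_hom[OF d(1)] ar_hom[OF c]] u h]
    by simp
  have "Comp C f ?e = Comp C g ?e"
    using pull[OF f k(2)] pull[OF g k(3)] k(4) d(2) by simp
  moreover have e: "?e \<in> hom C (FOb (Diag P) n) X"
    by (rule cod.comp_hom[OF ar_hom[OF dom.comp_hom[OF d(1) k(2)]] u])
  moreover have "FOb (Diag P) n \<in> Obj C"
    using dom.dom_closed d(1) ob_closed by (auto simp: hom_def)
  ultimately show ?thesis by blast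
qed

text \<open>
  The sets \<open>F X\<close> consist of elements of a set type, which has the two elements \<open>{}\<close> and
  \<open>UNIV\<close>; hence the strict epimorphisms between them are the surjections.
\<close>

lemma galois_functor_pro_hom:
  fixes C :: "('o, 'a) cat_data" and P :: "('i, 'j, 'o, 'a) pro_data"
  assumes P: "pro_object C P" and strict: "\<forall>f \<in> Arr C. strict_epi C f"
    and preserves: "preserves_strict_epi C Ens (pro_hom C P)"
  shows "galois_functor C (pro_hom C P)"
proof -
  let ?F = "pro_hom C P"
  interpret F: cat_functor C Ens ?F using cat_functor_pro_hom[OF P] .
  show ?thesis
  proof
    show "strict_epi C f" if "f \<in> Arr C" for f using strict that by blast
    show "ens_app (FAr ?F f) ` FOb ?F X = FOb ?F Y" if f: "f \<in> hom C X Y" for f X Y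
    proof -
      obtain m where m: "FAr ?F f = (FOb ?F X, m, FOb ?F Y)" "m \<in> FOb ?F X \<rightarrow>\<^sub>E FOb ?F Y"
        using F.ar_hom[OF f] by (auto simp: hom_Ens)
      have "strict_epi Ens (FOb ?F X, m, FOb ?F Y)"
        using f strict preserves m(1) by (auto simp: hom_def preserves_strict_epi_def)
      moreover have "({} :: ('i \<times> 'a) set) \<noteq> UNIV" by simp
      ultimately have "m ` FOb ?F X = FOb ?F Y" using strict_epi_Ens_iff[OF _ m(2)] by blast
      then show ?thesis by (simp add: m(1) ens_app_def)
    qed
  qed (rule pro_hom_common_source[OF P] pro_hom_equalized[OF P]; assumption)+
qed

section \<open>Categorical quotients by Galois groups\<close>

theorem theorem2p3:
  fixes C :: "('o, 'a) cat_data"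
    and P :: "('i, 'j, 'o, 'a) pro_data"
    and F :: "('o, 'a, ('i \<times> 'a) set set, ('i \<times> 'a) set ens_arr) functor_data"
  assumes "category C"
    and "pro_object C P"
    and F_def: "F = pro_hom C P"
    and all_strict_epi: "\<forall>f \<in> Arr C. strict_epi C f"
    and nonempty: "\<forall>X \<in> Obj C. FOb F X \<noteq> {}"
    and preserves: "preserves_strict_epi C Ens F"
  shows "(\<forall>X \<in> Obj C. \<forall>x \<in> FOb F X. is_categorical_quotient C P X x) \<and>
    (\<forall>X \<in> Obj C. \<forall>Y \<in> Obj C. \<forall>x \<in> FOb F X. \<forall>y \<in> FOb F Y.
      lFix C F X x \<subseteq> lFix C F Y y \<longrightarrow>
      (\<exists>!f. f \<in> hom C X Y \<and> ens_app (FAr F f) x = y))"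
proof -
  interpret galois_functor C F
    using galois_functor_pro_hom[OF assms(2) all_strict_epi] preserves unfolding F_def by blast
  show ?thesis
    using lifting unfolding is_categorical_quotient_def F_def[symmetric] by blast
qed

end
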